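(* Let $m,n\ge1$ and $r\ge0$ be integers. Suppose that $S\subseteq[m]\times[n]$ and that $\overline S=([m]\times[n])\setminus S$ contains at most two entries in the $m$th row. Then $\mathrm{mat}_q(m\times n,S,r)$ is equal to a linear combination of similar expressions for smaller matrices with coefficients in $\mathbf Z[q]$. That is, there exist finitely many tuples $(m_t,n_t,S_t,r_t)$ with $0\le m_t\le m$, $0\le n_t\le n$, $(m_t,n_t)\neq(m,n)$, $S_t\subseteq[m_t]\times[n_t]$, $r_t\ge0$, and polynomials $c_t(x)\in\mathbf Z[x]$, all independent of $q$, such that for every prime power $q$ $$\mathrm{mat}_q(m\times n,S,r)=\sum_t c_t(q)\,\mathrm{mat}_q(m_t\times n_t,S_t,r_t).$$
   Context: $[n]=\{1,\dots,n\}$ (and $[0]=\varnothing$). For integers $m,n,r\ge0$ and $S\subseteq[m]\times[n]$, $\mathrm{mat}_q(m\times n,S,r)$ denotes the number of $m\times n$ matrices $A=(a_{ij})$ over the field $\mathbf F_q$ with $q$ elements of rank $r$ such that $a_{ij}=0$ whenever $(i,j)\in S$. If $m=0$ or $n=0$ there is exactly one such (empty) matrix, of rank $0$. *)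

theory Defs
  imports
    "Jordan_Normal_Form.Missing_VectorSpace"
    "HOL-Computational_Algebra.Polynomial"
    "HOL-Number_Theory.Prime_Powers"
begin

(* Matrices are extensional functions on {1..m} \<times> {1..n}, so that index sets such as S and
   "the m-th row" are literal and there is exactly one matrix when m = 0 or n = 0.  Fields are
   HOL-Algebra records rather than type class instances, because the coefficients have to
   be chosen before the field; carriers inside nat suffice, since every finite field is isomorphic
   to one with carrier {0..<q}. *)

definition matrices :: "('a, 'b) ring_scheme \<Rightarrow> nat \<Rightarrow> nat \<Rightarrow> (nat \<times> nat \<Rightarrow> 'a) set" where
  "matrices F m n = ({1..m} \<times> {1..n}) \<rightarrow>\<^sub>E carrier F"

definition col_vec :: "nat \<Rightarrow> (nat \<times> nat \<Rightarrow> 'a) \<Rightarrow> nat \<Rightarrow> (nat \<Rightarrow> 'a)" where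
  "col_vec m A j = (\<lambda>i\<in>{1..m}. A (i, j))"

(* The dimension of the column space inside F^m = ring.func_space F {1..m}; this transcribes
   vec_space.rank of Jordan_Normal_Form from the field type class to field records. *)
definition mat_rank :: "('a, 'b) ring_scheme \<Rightarrow> nat \<Rightarrow> nat \<Rightarrow> (nat \<times> nat \<Rightarrow> 'a) \<Rightarrow> nat" where
  "mat_rank F m n A =
     (let V = ring.func_space F {1..m}
      in vectorspace.dim F (V\<lparr>carrier := LinearCombinations.module.span F V (col_vec m A ` {1..n})\<rparr>))"

definition mat_count ::
  "('a, 'b) ring_scheme \<Rightarrow> nat \<Rightarrow> nat \<Rightarrow> (nat \<times> nat) set \<Rightarrow> nat \<Rightarrow> nat" where
  "mat_count F m n S r =
     card {A \<in> matrices F m n. mat_rank F m n A = r \<and> (\<forall>(i, j)\<in>S. A (i, j) = \<zero>\<^bsub>F\<^esub>)}"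

end

theory Submission
  imports Defs
begin

text \<open>
  Fix the last row \<open>v\<close> of a matrix and let \<open>K\<close> be the set of columns in which \<open>v\<close> is nonzero.
  If \<open>K\<close> is empty, the last row can be dropped without changing the rank.  Otherwise choose a pivot
  \<open>p \<in> K\<close> and use the entry \<open>v p\<close> to clear all other entries of the last row by column operations.
  The cleared matrix has rank one more than the block \<open>B\<close> left after deleting the last row and column
  \<open>p\<close>, since column \<open>p\<close> has become independent of the others.

  The column operations only alter the columns in \<open>K - {p}\<close>.  As \<open>K\<close> has at most two elements, there
  is at most one such column \<open>k\<close>, and in row \<open>i\<close> it receives \<open>A (i, k) - A (i, p) * c\<close> with \<open>c \<noteq> 0\<close>.  So the
  new entry is forced to vanish exactly when both old entries are, and otherwise it is arbitrary:
  \<open>B\<close> ranges over all matrices with a prescribed set of zeros (\<open>merge_cols\<close>).  Each \<open>B\<close> comes from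
  \<open>q\<close> choices per row in which every entry of the columns in \<open>K\<close> is free (\<open>free_rows\<close>) and from
  one choice in every other row.  With three or more columns in \<open>K\<close> this breaks down: a row in which
  only \<open>p\<close> is free would impose a linear relation between several entries of \<open>B\<close>.  That is where the
  hypothesis on the last row enters.

  Only the support of \<open>v\<close> matters, and a support \<open>K\<close> is realised by \<open>(q - 1) ^ card K\<close> rows.  Summing
  over the subsets \<open>K\<close> of the free positions of the last row gives \<open>count_mats_recursion\<close>, at most four
  terms whose coefficients are polynomials in \<open>q\<close>.

  Over a field with \<open>q\<close> elements, rank \<open>r\<close> means that the column space has \<open>q ^ r\<close> elements
  (\<open>card_col_space\<close>).  The whole argument is therefore carried out with cardinalities, for matrices
  indexed by arbitrary finite sets; dimensions occur only in that translation, and the deletion of a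
  column is turned back into indices \<open>1, ..., n - 1\<close> at the very end.
\<close>

section \<open>Column spaces over a finite field\<close>

locale finite_field = field F for F (structure) +
  assumes finite_carrier: "finite (carrier F)"
begin

abbreviation q :: nat where "q \<equiv> card (carrier F)"

lemma q_ge_2: "q \<ge> 2"
proof -
  have "card {\<zero>, \<one>} \<le> q"
    by (rule card_mono) (auto simp: finite_carrier)
  then show ?thesis by simp
qed

definition col_space :: "'i set \<Rightarrow> 'j set \<Rightarrow> ('i \<times> 'j \<Rightarrow> 'a) \<Rightarrow> ('i \<Rightarrow> 'a) set" where
  "col_space I J A = (\<lambda>x. \<lambda>i\<in>I. \<Oplus>j\<in>J. A (i, j) \<otimes> x j) ` (J \<rightarrow>\<^sub>E carrier F)"

text \<open>
  Entries of \<open>S\<close> outside \<open>I \<times> J\<close> are harmless in this form, so rows and columns can be deleted without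
  trimming \<open>S\<close>.
\<close>

definition mats :: "'i set \<Rightarrow> 'j set \<Rightarrow> ('i \<times> 'j) set \<Rightarrow> ('i \<times> 'j \<Rightarrow> 'a) set" where
  "mats I J S = (\<Pi>\<^sub>E p\<in>I \<times> J. if p \<in> S then {\<zero>} else carrier F)"

text \<open>
  The rank condition is encoded by the cardinality \<open>s\<close> of the column space, so the rank \<open>r\<close> matrices
  are those with \<open>s = q ^ r\<close>.
\<close>

definition count_mats :: "'i set \<Rightarrow> 'j set \<Rightarrow> ('i \<times> 'j) set \<Rightarrow> nat \<Rightarrow> nat" where
  "count_mats I J S s = card {A \<in> mats I J S. card (col_space I J A) = s}"

lemma matsD: "A \<in> mats I J S \<Longrightarrow> i \<in> I \<Longrightarrow> j \<in> J \<Longrightarrow> A (i, j) \<in> carrier F"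
  unfolding mats_def by (drule PiE_mem[where x = "(i, j)"]) (auto split: if_splits)

lemma matsD0: "A \<in> mats I J S \<Longrightarrow> i \<in> I \<Longrightarrow> j \<in> J \<Longrightarrow> (i, j) \<in> S \<Longrightarrow> A (i, j) = \<zero>"
  unfolding mats_def by (drule PiE_mem[where x = "(i, j)"]) (auto split: if_splits)

lemma matsD_undefined: "A \<in> mats I J S \<Longrightarrow> \<not> (i \<in> I \<and> j \<in> J) \<Longrightarrow> A (i, j) = undefined"
  unfolding mats_def by (drule PiE_arb[where x = "(i, j)"]) auto

lemma matsI:
  assumes "\<And>i j. i \<in> I \<Longrightarrow> j \<in> J \<Longrightarrow> A (i, j) \<in> carrier F"
    and "\<And>i j. i \<in> I \<Longrightarrow> j \<in> J \<Longrightarrow> (i, j) \<in> S \<Longrightarrow> A (i, j) = \<zero>"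
    and "\<And>i j. \<not> (i \<in> I \<and> j \<in> J) \<Longrightarrow> A (i, j) = undefined"
  shows "A \<in> mats I J S"
  unfolding mats_def
proof (rule PiE_I)
  fix p assume "p \<notin> I \<times> J"
  then show "A p = undefined" using assms(3)[of "fst p" "snd p"] by (auto simp: mem_Times_iff)
qed (use assms(1,2) in auto)

lemma finite_mats: "finite I \<Longrightarrow> finite J \<Longrightarrow> finite (mats I J S)"
  unfolding mats_def by (auto intro!: finite_PiE simp: finite_carrier)

lemma col_space_subset:
  assumes "\<And>i j. i \<in> I \<Longrightarrow> j \<in> J \<Longrightarrow> A (i, j) \<in> carrier F"
  shows "col_space I J A \<subseteq> I \<rightarrow>\<^sub>E carrier F"
proof
  fix y assume "y \<in> col_space I J A"
  then obtain x where x: "x \<in> J \<rightarrow>\<^sub>E carrier F" "y = (\<lambda>i\<in>I. \<Oplus>j\<in>J. A (i, j) \<otimes> x j)"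
    unfolding col_space_def by auto
  have xc: "x j \<in> carrier F" if "j \<in> J" for j using x(1) that by (rule PiE_mem)
  have "(\<Oplus>j\<in>J. A (i, j) \<otimes> x j) \<in> carrier F" if "i \<in> I" for i
    using assms that xc by (intro finsum_closed) auto
  then show "y \<in> I \<rightarrow>\<^sub>E carrier F" using x(2) by auto
qed

text \<open>
  A basis \<open>B\<close> identifies the space with the coefficient functions \<open>B \<rightarrow>\<^sub>E carrier F\<close>.
\<close>

lemma card_vectorspace:
  assumes "vectorspace F V" and "vectorspace.fin_dim F V"
  shows "card (carrier V) = q ^ vectorspace.dim F V"
proof -
  interpret V: vectorspace F V by fact
  obtain B where B: "finite B" "V.basis B"
    using V.finite_basis_exists[OF assms(2)] by auto
  have BV: "B \<subseteq> carrier V"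
    using B(2) by (simp add: V.basis_def)
  have ex: "\<exists>!a. a \<in> B \<rightarrow>\<^sub>E carrier F \<and> V.lincomb a B = v" if "v \<in> carrier V" for v
    using V.basis_criterion[OF B(1) BV] B(2) that by blast
  have "bij_betw (\<lambda>a. V.lincomb a B) (B \<rightarrow>\<^sub>E carrier F) (carrier V)"
  proof (rule bij_betwI')
    fix a b assume a: "a \<in> B \<rightarrow>\<^sub>E carrier F" and b: "b \<in> B \<rightarrow>\<^sub>E carrier F"
    show "(V.lincomb a B = V.lincomb b B) = (a = b)"
      using ex[of "V.lincomb a B"] a b V.lincomb_closed[OF BV, of a] by (auto simp: PiE_def)
  next
    fix a assume a: "a \<in> B \<rightarrow>\<^sub>E carrier F"
    show "V.lincomb a B \<in> carrier V"
      using a V.lincomb_closed[OF BV, of a] by (auto simp: PiE_def)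
  next
    fix v assume "v \<in> carrier V"
    then show "\<exists>a\<in>B \<rightarrow>\<^sub>E carrier F. v = V.lincomb a B" using ex by blast
  qed
  then have "card (carrier V) = card (B \<rightarrow>\<^sub>E carrier F)"
    by (simp add: bij_betw_same_card)
  also have "\<dots> = q ^ card B"
    using B(1) by (simp add: card_PiE)
  finally show ?thesis
    using V.dim_basis[OF B] by simp
qed

lemma vectorspace_func_space: "vectorspace F (func_space I)"
proof -
  have "Module.module F (func_space I)" by (rule func_space_is_module)
  then show ?thesis by (simp add: vectorspace_def field_axioms)
qed

lemma submodule_col_space:
  assumes "\<And>i j. i \<in> I \<Longrightarrow> j \<in> J \<Longrightarrow> A (i, j) \<in> carrier F"
  shows "LinearCombinations.submodule F (col_space I J A) (func_space I)"
proof (rule LinearCombinations.submodule.intro)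
  show "Module.module F (func_space I)" by (rule func_space_is_module)
  show "col_space I J A \<subseteq> carrier (func_space I)"
    using col_space_subset[of I J A] assms by (simp add: func_space_def)
next
  fix v w assume "v \<in> col_space I J A" "w \<in> col_space I J A"
  then obtain x y where x: "x \<in> J \<rightarrow>\<^sub>E carrier F" "v = (\<lambda>i\<in>I. \<Oplus>j\<in>J. A (i, j) \<otimes> x j)"
    and y: "y \<in> J \<rightarrow>\<^sub>E carrier F" "w = (\<lambda>i\<in>I. \<Oplus>j\<in>J. A (i, j) \<otimes> y j)"
    unfolding col_space_def by auto
  have xc: "x j \<in> carrier F" if "j \<in> J" for j using x(1) that by (rule PiE_mem)
  have yc: "y j \<in> carrier F" if "j \<in> J" for j using y(1) that by (rule PiE_mem)
  have "(\<Oplus>j\<in>J. A (i, j) \<otimes> (\<lambda>j\<in>J. x j \<oplus> y j) j)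
      = (\<Oplus>j\<in>J. A (i, j) \<otimes> x j) \<oplus> (\<Oplus>j\<in>J. A (i, j) \<otimes> y j)" if "i \<in> I" for i
  proof -
    have "(\<Oplus>j\<in>J. A (i, j) \<otimes> (\<lambda>j\<in>J. x j \<oplus> y j) j) = (\<Oplus>j\<in>J. A (i, j) \<otimes> x j \<oplus> A (i, j) \<otimes> y j)"
      using xc yc assms that by (intro finsum_cong') (auto simp: r_distr)
    also have "\<dots> = (\<Oplus>j\<in>J. A (i, j) \<otimes> x j) \<oplus> (\<Oplus>j\<in>J. A (i, j) \<otimes> y j)"
      using xc yc assms that by (intro finsum_addf) auto
    finally show ?thesis .
  qed
  then have "v \<oplus>\<^bsub>func_space I\<^esub> w = (\<lambda>i\<in>I. \<Oplus>j\<in>J. A (i, j) \<otimes> (\<lambda>j\<in>J. x j \<oplus> y j) j)"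
    unfolding x(2) y(2) func_space_def by (auto intro!: restrict_ext)
  moreover have "(\<lambda>j\<in>J. x j \<oplus> y j) \<in> J \<rightarrow>\<^sub>E carrier F"
    using xc yc by auto
  ultimately show "v \<oplus>\<^bsub>func_space I\<^esub> w \<in> col_space I J A"
    unfolding col_space_def by (rule image_eqI)
next
  have "(\<Oplus>j\<in>J. A (i, j) \<otimes> (\<lambda>j\<in>J. \<zero>) j) = \<zero>" if "i \<in> I" for i
    using assms that by (intro add.finprod_one_eqI) auto
  then have "\<zero>\<^bsub>func_space I\<^esub> = (\<lambda>i\<in>I. \<Oplus>j\<in>J. A (i, j) \<otimes> (\<lambda>j\<in>J. \<zero>) j)"
    unfolding func_space_def by (auto intro!: restrict_ext)
  moreover have "(\<lambda>j\<in>J. \<zero>) \<in> J \<rightarrow>\<^sub>E carrier F" by auto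
  ultimately show "\<zero>\<^bsub>func_space I\<^esub> \<in> col_space I J A"
    unfolding col_space_def by (rule image_eqI)
next
  fix c v assume c: "c \<in> carrier F" and "v \<in> col_space I J A"
  then obtain x where x: "x \<in> J \<rightarrow>\<^sub>E carrier F" "v = (\<lambda>i\<in>I. \<Oplus>j\<in>J. A (i, j) \<otimes> x j)"
    unfolding col_space_def by auto
  have xc: "x j \<in> carrier F" if "j \<in> J" for j using x(1) that by (rule PiE_mem)
  have "(\<Oplus>j\<in>J. A (i, j) \<otimes> (\<lambda>j\<in>J. c \<otimes> x j) j) = c \<otimes> (\<Oplus>j\<in>J. A (i, j) \<otimes> x j)"
    if "i \<in> I" for i
  proof -
    have xc: "x j \<in> carrier F" if "j \<in> J" for j using x(1) that by (rule PiE_mem)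
  have "(\<Oplus>j\<in>J. A (i, j) \<otimes> (\<lambda>j\<in>J. c \<otimes> x j) j) = (\<Oplus>j\<in>J. c \<otimes> (A (i, j) \<otimes> x j))"
      using xc c assms that by (intro finsum_cong') (auto simp: m_lcomm)
    also have "\<dots> = c \<otimes> (\<Oplus>j\<in>J. A (i, j) \<otimes> x j)"
    proof (cases "finite J")
      case True
      then show ?thesis
        using xc c assms that by (intro finsum_rdistr[symmetric]) auto
    qed (use c in \<open>auto simp: finsum_infinite\<close>)
    finally show ?thesis .
  qed
  then have "c \<odot>\<^bsub>func_space I\<^esub> v = (\<lambda>i\<in>I. \<Oplus>j\<in>J. A (i, j) \<otimes> (\<lambda>j\<in>J. c \<otimes> x j) j)"
    unfolding x(2) func_space_def by (auto intro!: restrict_ext)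
  moreover have "(\<lambda>j\<in>J. c \<otimes> x j) \<in> J \<rightarrow>\<^sub>E carrier F"
    using xc c by auto
  ultimately show "c \<odot>\<^bsub>func_space I\<^esub> v \<in> col_space I J A"
    unfolding col_space_def by (rule image_eqI)
qed

text \<open>
  The span is built from finite sets of distinct vectors, whereas \<open>col_space\<close> sums over column indices,
  and columns may repeat.  Rather than matching coefficients, both inclusions use closure: the column
  space is a submodule containing the columns, and the span is closed under the partial sums.
\<close>

lemma span_columns:
  assumes "finite J" and A: "\<And>i j. i \<in> I \<Longrightarrow> j \<in> J \<Longrightarrow> A (i, j) \<in> carrier F"
  shows "LinearCombinations.module.span F (func_space I) ((\<lambda>j. \<lambda>i\<in>I. A (i, j)) ` J) = col_space I J A"
    (is "LinearCombinations.module.span F ?V ?C = _")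
proof -
  interpret V: vectorspace F ?V by (rule vectorspace_func_space)
  have C: "?C \<subseteq> carrier ?V"
    using A by (auto simp: func_space_def)
  interpret S: LinearCombinations.submodule F "V.span ?C" ?V by (rule V.span_is_submodule[OF C])
  show ?thesis
  proof
    have "?C \<subseteq> col_space I J A"
    proof safe
      fix k assume k: "k \<in> J"
      \<comment> \<open>Column \<open>k\<close> is the image of the unit vector at \<open>k\<close>.\<close>
      define x where "x = (\<lambda>j\<in>J. if k = j then \<one> else \<zero>)"
      have "(\<Oplus>j\<in>J. A (i, j) \<otimes> x j) = A (i, k)" if "i \<in> I" for i
      proof -
        have "(\<Oplus>j\<in>J. A (i, j) \<otimes> x j) = (\<Oplus>j\<in>J. if k = j then A (i, j) else \<zero>)"
          using A that by (intro finsum_cong') (auto simp: x_def)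
        also have "\<dots> = A (i, k)"
          using k assms that by (intro add.finprod_singleton) auto
        finally show ?thesis .
      qed
      then have "(\<lambda>i\<in>I. A (i, k)) = (\<lambda>i\<in>I. \<Oplus>j\<in>J. A (i, j) \<otimes> x j)"
        by (auto intro!: restrict_ext)
      moreover have "x \<in> J \<rightarrow>\<^sub>E carrier F" by (auto simp: x_def)
      ultimately show "(\<lambda>i\<in>I. A (i, k)) \<in> col_space I J A"
        unfolding col_space_def by (rule image_eqI)
    qed
    then show "V.span ?C \<subseteq> col_space I J A"
      by (rule V.span_is_subset) (rule submodule_col_space, rule A)
  next
    show "col_space I J A \<subseteq> V.span ?C"
    proof
      fix y assume "y \<in> col_space I J A"
      then obtain x where x: "x \<in> J \<rightarrow>\<^sub>E carrier F" "y = (\<lambda>i\<in>I. \<Oplus>j\<in>J. A (i, j) \<otimes> x j)"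
        unfolding col_space_def by auto
      have xc: "x j \<in> carrier F" if "j \<in> J" for j using x(1) that by (rule PiE_mem)
      have "(\<lambda>i\<in>I. \<Oplus>j\<in>K. A (i, j) \<otimes> x j) \<in> V.span ?C" if "K \<subseteq> J" for K
        using finite_subset[OF that assms(1)] that
      proof (induction K)
        case empty
        have eq: "\<zero>\<^bsub>?V\<^esub> = (\<lambda>i\<in>I. \<Oplus>j\<in>{}. A (i, j) \<otimes> x j)" by (simp add: func_space_def)
        show ?case using S.zero_closed unfolding eq .
      next
        case (insert k K)
        let ?w = "\<lambda>i\<in>I. A (i, k)" and ?u = "\<lambda>i\<in>I. \<Oplus>j\<in>K. A (i, j) \<otimes> x j"
        have "?w \<in> V.span ?C"
          using V.in_own_span[OF C] insert.prems by auto
        moreover have "x k \<in> carrier F" using xc insert.prems by auto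
        moreover have "?u \<in> V.span ?C" using insert.prems by (intro insert.IH) auto
        ultimately have "x k \<odot>\<^bsub>?V\<^esub> ?w \<oplus>\<^bsub>?V\<^esub> ?u \<in> V.span ?C"
          by (intro S.m_closed S.smult_closed)
        also have "x k \<odot>\<^bsub>?V\<^esub> ?w \<oplus>\<^bsub>?V\<^esub> ?u = (\<lambda>i\<in>I. \<Oplus>j\<in>insert k K. A (i, j) \<otimes> x j)"
          unfolding func_space_def
        proof (simp, intro restrict_ext)
          fix i assume i: "i \<in> I"
          have "(\<Oplus>j\<in>insert k K. A (i, j) \<otimes> x j) = A (i, k) \<otimes> x k \<oplus> (\<Oplus>j\<in>K. A (i, j) \<otimes> x j)"
            using insert xc A i by (intro finsum_insert) auto
          then show "(if i \<in> I then x k \<otimes> (if i \<in> I then A (i, k) else undefined) else undefined) \<oplus>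
              (if i \<in> I then \<Oplus>j\<in>K. A (i, j) \<otimes> x j else undefined)
            = (\<Oplus>j\<in>insert k K. A (i, j) \<otimes> x j)"
            using i A insert.prems xc by (simp add: m_comm)
        qed
        finally show ?case .
      qed
      from this[of J] show "y \<in> V.span ?C" using x by simp
    qed
  qed
qed

lemma card_col_space:
  assumes "A \<in> matrices F m n"
  shows "card (col_space {1..m} {1..n} A) = q ^ mat_rank F m n A"
proof -
  let ?V = "func_space {1..m}" and ?C = "(\<lambda>j. \<lambda>i\<in>{1..m}. A (i, j)) ` {1..n}"
  interpret V: vectorspace F ?V by (rule vectorspace_func_space)
  have A: "A (i, j) \<in> carrier F" if "i \<in> {1..m}" "j \<in> {1..n}" for i j
    using assms that unfolding matrices_def by (auto dest: PiE_mem[where x = "(i, j)"])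
  have C: "?C \<subseteq> carrier ?V" using A by (auto simp: func_space_def)
  have span: "V.span ?C = col_space {1..m} {1..n} A"
    by (rule span_columns) (use A in auto)
  have sub: "LinearCombinations.submodule F (V.span ?C) ?V" by (rule V.span_is_submodule[OF C])
  let ?W = "?V\<lparr>carrier := V.span ?C\<rparr>"
  have W: "vectorspace F ?W" using V.span_is_subspace[OF C] by (rule V.subspace_is_vs)
  interpret W: vectorspace F ?W by fact
  have "W.span ?C = V.span ?C"
    by (rule V.span_li_not_depend(1)[OF V.in_own_span[OF C] sub])
  then have "W.fin_dim"
    unfolding W.fin_dim_def using V.in_own_span[OF C] by (intro exI[of _ ?C]) auto
  then have "card (carrier ?W) = q ^ W.dim" by (rule card_vectorspace[OF W])
  then show ?thesis
    unfolding mat_rank_def col_vec_def Let_def using span by simp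
qed

lemma mat_count_eq_count_mats:
  assumes "S \<subseteq> {1..m} \<times> {1..n}"
  shows "mat_count F m n S r = count_mats {1..m} {1..n} S (q ^ r)"
proof -
  have "A \<in> mats {1..m} {1..n} S \<longleftrightarrow> A \<in> matrices F m n \<and> (\<forall>(i, j)\<in>S. A (i, j) = \<zero>)" for A
  proof
    assume A: "A \<in> mats {1..m} {1..n} S"
    then have "A \<in> matrices F m n"
      unfolding matrices_def mats_def by (rule PiE_mono[THEN subsetD, rotated]) auto
    then show "A \<in> matrices F m n \<and> (\<forall>(i, j)\<in>S. A (i, j) = \<zero>)"
      using matsD0[OF A] assms by blast
  next
    assume A: "A \<in> matrices F m n \<and> (\<forall>(i, j)\<in>S. A (i, j) = \<zero>)"
    show "A \<in> mats {1..m} {1..n} S"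
    proof (rule matsI)
      show "A (i, j) \<in> carrier F" if "i \<in> {1..m}" "j \<in> {1..n}" for i j
        using A that unfolding matrices_def by (auto dest: PiE_mem[where x = "(i, j)"])
      show "A (i, j) = undefined" if "\<not> (i \<in> {1..m} \<and> j \<in> {1..n})" for i j
        using A that PiE_arb[of A "{1..m} \<times> {1..n}" _ "(i, j)"] unfolding matrices_def by auto
    qed (use A in blast)
  qed
  moreover have "card (col_space {1..m} {1..n} A) = q ^ r \<longleftrightarrow> mat_rank F m n A = r"
    if "A \<in> matrices F m n" for A
    using card_col_space[OF that] q_ge_2 by (simp add: power_inject_exp)
  ultimately have "{A \<in> matrices F m n. mat_rank F m n A = r \<and> (\<forall>(i, j)\<in>S. A (i, j) = \<zero>)}
      = {A \<in> mats {1..m} {1..n} S. card (col_space {1..m} {1..n} A) = q ^ r}"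
    by blast
  then show ?thesis
    unfolding mat_count_def count_mats_def by simp
qed

section \<open>Splitting off the last row\<close>

definition add_row :: "'i \<Rightarrow> ('j \<Rightarrow> 'a) \<Rightarrow> ('i \<times> 'j \<Rightarrow> 'a) \<Rightarrow> 'i \<times> 'j \<Rightarrow> 'a" where
  "add_row m v A = (\<lambda>(i, j). if i = m then v j else A (i, j))"

abbreviation rows :: "'i \<Rightarrow> 'j set \<Rightarrow> ('i \<times> 'j) set \<Rightarrow> ('j \<Rightarrow> 'a) set" where
  "rows m J S \<equiv> (\<Pi>\<^sub>E j\<in>J. if (m, j) \<in> S then {\<zero>} else carrier F)"

lemma rowsD: "v \<in> rows m J S \<Longrightarrow> j \<in> J \<Longrightarrow> v j \<in> carrier F"
  by (drule PiE_mem[where x = j]) (auto split: if_splits)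

lemma rowsD0: "v \<in> rows m J S \<Longrightarrow> j \<in> J \<Longrightarrow> (m, j) \<in> S \<Longrightarrow> v j = \<zero>"
  by (drule PiE_mem[where x = j]) (auto split: if_splits)

text \<open>
  Separates the last row from the rest, so that the count can be organised by the last row.
\<close>

lemma bij_betw_add_row:
  assumes "m \<notin> I"
  shows "bij_betw (\<lambda>(v, A). add_row m v A) (rows m J S \<times> mats I J S) (mats (insert m I) J S)"
proof (rule bij_betw_byWitness
    [where f' = "\<lambda>B. (\<lambda>j\<in>J. B (m, j), restrict B (I \<times> J))"])
  show "\<forall>a\<in>rows m J S \<times> mats I J S.
      (\<lambda>j\<in>J. (case a of (v, A) \<Rightarrow> add_row m v A) (m, j),
       restrict (case a of (v, A) \<Rightarrow> add_row m v A) (I \<times> J)) = a"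
  proof
    fix a assume "a \<in> rows m J S \<times> mats I J S"
    then obtain v A where a: "a = (v, A)" and v: "v \<in> rows m J S" and A: "A \<in> mats I J S" by auto
    have "(\<lambda>j\<in>J. add_row m v A (m, j)) = v"
      using PiE_arb[OF v] by (auto simp: add_row_def)
    moreover have "restrict (add_row m v A) (I \<times> J) p = A p" for p
      using matsD_undefined[OF A, of "fst p" "snd p"] assms
      by (cases p) (auto simp: add_row_def)
    ultimately show "(\<lambda>j\<in>J. (case a of (v, A) \<Rightarrow> add_row m v A) (m, j),
       restrict (case a of (v, A) \<Rightarrow> add_row m v A) (I \<times> J)) = a"
      unfolding a by auto
  qed
  show "\<forall>B\<in>mats (insert m I) J S.
      (case (\<lambda>j\<in>J. B (m, j), restrict B (I \<times> J)) of (v, A) \<Rightarrow> add_row m v A) = B"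
  proof
    fix B assume B: "B \<in> mats (insert m I) J S"
    have "add_row m (\<lambda>j\<in>J. B (m, j)) (restrict B (I \<times> J)) p = B p" for p
      using matsD_undefined[OF B, of "fst p" "snd p"] by (cases p) (auto simp: add_row_def)
    then show "(case (\<lambda>j\<in>J. B (m, j), restrict B (I \<times> J)) of (v, A) \<Rightarrow> add_row m v A) = B"
      by auto
  qed
  show "(\<lambda>(v, A). add_row m v A) ` (rows m J S \<times> mats I J S) \<subseteq> mats (insert m I) J S"
  proof safe
    fix v A assume v: "v \<in> rows m J S" and A: "A \<in> mats I J S"
    show "add_row m v A \<in> mats (insert m I) J S"
      using matsD[OF A] matsD0[OF A] matsD_undefined[OF A] rowsD[OF v] rowsD0[OF v] PiE_arb[OF v]
      by (intro matsI) (auto simp: add_row_def)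
  qed
  show "(\<lambda>B. (\<lambda>j\<in>J. B (m, j), restrict B (I \<times> J))) ` mats (insert m I) J S
      \<subseteq> rows m J S \<times> mats I J S"
  proof (rule image_subsetI)
    fix B assume B: "B \<in> mats (insert m I) J S"
    have "restrict B (I \<times> J) \<in> mats I J S"
      using matsD[OF B] matsD0[OF B] by (intro matsI) auto
    moreover have "(\<lambda>j\<in>J. B (m, j)) \<in> rows m J S"
      using matsD[OF B] matsD0[OF B] by (intro PiE_I) auto
    ultimately show "(\<lambda>j\<in>J. B (m, j), restrict B (I \<times> J)) \<in> rows m J S \<times> mats I J S"
      by simp
  qed
qed

lemma count_mats_insert_row:
  assumes "m \<notin> I" and "finite I" and "finite J"
  shows "count_mats (insert m I) J S s =
    (\<Sum>v\<in>rows m J S. card {A \<in> mats I J S. card (col_space (insert m I) J (add_row m v A)) = s})"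
proof -
  let ?N = "\<lambda>v. {A \<in> mats I J S. card (col_space (insert m I) J (add_row m v A)) = s}"
  note bij = bij_betw_add_row[OF assms(1), of J S]
  have "{B \<in> mats (insert m I) J S. card (col_space (insert m I) J B) = s}
      = (\<lambda>(v, A). add_row m v A) ` (SIGMA v:rows m J S. ?N v)" (is "?L = _")
    unfolding bij_betw_imp_surj_on[OF bij, symmetric] by auto
  moreover have "inj_on (\<lambda>(v, A). add_row m v A) (SIGMA v:rows m J S. ?N v)"
    by (rule inj_on_subset[OF bij_betw_imp_inj_on[OF bij]]) auto
  ultimately have "card ?L = card (SIGMA v:rows m J S. ?N v)"
    by (simp add: card_image)
  also have "\<dots> = (\<Sum>v\<in>rows m J S. card (?N v))"
    using assms finite_mats[of I J S]
    by (intro card_SigmaI finite_PiE) (auto simp: finite_carrier)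
  finally show ?thesis unfolding count_mats_def .
qed

text \<open>
  All vectors of the larger column space vanish at \<open>m\<close>, so forgetting that coordinate is injective.
\<close>

lemma card_col_space_zero_row:
  assumes "m \<notin> I" and "\<And>i j. i \<in> I \<Longrightarrow> j \<in> J \<Longrightarrow> A (i, j) \<in> carrier F"
    and "\<And>j. j \<in> J \<Longrightarrow> v j = \<zero>"
  shows "card (col_space (insert m I) J (add_row m v A)) = card (col_space I J A)"
proof -
  let ?B = "col_space (insert m I) J (add_row m v A)"
  have zero: "y m = \<zero>" if "y \<in> ?B" for y
  proof -
    obtain x where x: "x \<in> J \<rightarrow>\<^sub>E carrier F"
      "y = (\<lambda>i\<in>insert m I. \<Oplus>j\<in>J. add_row m v A (i, j) \<otimes> x j)"
      using \<open>y \<in> ?B\<close> unfolding col_space_def by auto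
    have xc: "x j \<in> carrier F" if "j \<in> J" for j using x(1) that by (rule PiE_mem)
    have "y m = (\<Oplus>j\<in>J. v j \<otimes> x j)" by (simp add: x(2) add_row_def)
    also have "\<dots> = \<zero>" using assms(3) xc by (intro add.finprod_one_eqI) auto
    finally show ?thesis .
  qed
  have ext: "y i = undefined" if "y \<in> ?B" "i \<notin> insert m I" for y i
    using that unfolding col_space_def by auto
  have "inj_on (\<lambda>y. restrict y I) ?B"
  proof (rule inj_onI)
    fix y z assume y: "y \<in> ?B" and z: "z \<in> ?B" and eq: "restrict y I = restrict z I"
    have "y i = z i" for i
      using fun_cong[OF eq, of i] zero[OF y] zero[OF z] ext[OF y, of i] ext[OF z, of i]
      by (cases "i = m"; cases "i \<in> I") auto
    then show "y = z" by auto
  qed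
  moreover have "(\<lambda>y. restrict y I) ` ?B = col_space I J A"
    unfolding col_space_def image_image
  proof (intro image_cong refl)
    fix x
    have "i \<noteq> m" if "i \<in> I" for i using that assms(1) by auto
    then show "restrict (\<lambda>i\<in>insert m I. \<Oplus>j\<in>J. add_row m v A (i, j) \<otimes> x j) I
        = (\<lambda>i\<in>I. \<Oplus>j\<in>J. A (i, j) \<otimes> x j)"
      by (auto simp: add_row_def fun_eq_iff)
  qed
  ultimately show ?thesis by (metis card_image)
qed

text \<open>
  The block that remains when the column operations with pivot \<open>v p\<close> have cleared the last row, and
  that row and column \<open>p\<close> are deleted.
\<close>

definition eliminate :: "'i set \<Rightarrow> 'j set \<Rightarrow> 'j \<Rightarrow> ('j \<Rightarrow> 'a) \<Rightarrow> ('i \<times> 'j \<Rightarrow> 'a) \<Rightarrow> 'i \<times> 'j \<Rightarrow> 'a" where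
  "eliminate I J p v A = (\<lambda>(i, l)\<in>I \<times> (J - {p}). A (i, l) \<ominus> A (i, p) \<otimes> (inv (v p) \<otimes> v l))"

lemma inv_closed: "a \<in> carrier F \<Longrightarrow> a \<noteq> \<zero> \<Longrightarrow> inv a \<in> carrier F"
  by (simp add: field_Units)

lemma inv_mult: "a \<in> carrier F \<Longrightarrow> a \<noteq> \<zero> \<Longrightarrow> inv a \<otimes> a = \<one>"
  by (simp add: field_Units)

lemma mult_inv: "a \<in> carrier F \<Longrightarrow> a \<noteq> \<zero> \<Longrightarrow> a \<otimes> inv a = \<one>"
  by (simp add: field_Units)

lemma add_minus_cancel: "a \<in> carrier F \<Longrightarrow> b \<in> carrier F \<Longrightarrow> (a \<ominus> b) \<oplus> b = a"
  by (simp add: minus_eq a_assoc l_neg)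

lemma minus_add_cancel: "a \<in> carrier F \<Longrightarrow> b \<in> carrier F \<Longrightarrow> (a \<oplus> b) \<ominus> b = a"
  by (simp add: minus_eq a_assoc r_neg)

text \<open>
  Eliminating with the pivot lowers the rank by one.  The entries of \<open>eliminate\<close> can also be read as
  the result of a row operation, subtracting \<open>d i = A (i, p) * inv (v p)\<close> times the last row from row
  \<open>i\<close>.  Applied to a vector \<open>u\<close> of the column space, this is the map \<open>\<Phi>\<close> below, which also records the last
  coordinate.  It is injective because row operations are invertible.  After it column \<open>p\<close> is zero
  outside the last row, so the remaining coordinates are a combination of the other columns, while
  the coefficient of column \<open>p\<close> can still give the last coordinate any value.  Hence \<open>\<Phi>\<close> is
  onto a product with \<open>carrier F\<close>, which accounts for the factor \<open>q\<close>.
\<close>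

lemma card_col_space_pivot:
  assumes "m \<notin> I" and "finite J" and p: "p \<in> J" "v p \<noteq> \<zero>"
    and A: "\<And>i j. i \<in> I \<Longrightarrow> j \<in> J \<Longrightarrow> A (i, j) \<in> carrier F"
    and v: "\<And>j. j \<in> J \<Longrightarrow> v j \<in> carrier F"
  shows "card (col_space (insert m I) J (add_row m v A))
    = q * card (col_space I (J - {p}) (eliminate I J p v A))"
proof -
  let ?L = "col_space (insert m I) J (add_row m v A)"
  let ?R = "eliminate I J p v A"
  define d where "d i = A (i, p) \<otimes> inv (v p)" for i
  define y where "y x = (\<lambda>i\<in>insert m I. \<Oplus>j\<in>J. add_row m v A (i, j) \<otimes> x j)" for x
  define z where "z x = (\<lambda>i\<in>I. \<Oplus>j\<in>J - {p}. ?R (i, j) \<otimes> x j)" for x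
  define \<Phi> where "\<Phi> u = (u m, \<lambda>i\<in>I. u i \<ominus> d i \<otimes> u m)" for u
  have L: "?L = y ` (J \<rightarrow>\<^sub>E carrier F)" by (simp add: col_space_def y_def)
  have ip: "inv (v p) \<in> carrier F" using p v by (intro inv_closed) auto
  have d: "d i \<in> carrier F" if "i \<in> I" for i using A[OF that p(1)] ip by (simp add: d_def)
  have R: "?R (i, l) = A (i, l) \<ominus> d i \<otimes> v l" if "i \<in> I" "l \<in> J - {p}" for i l
    using that A[OF that(1) p(1)] ip v[of l] by (simp add: eliminate_def d_def m_assoc)
  have Rc: "?R (i, l) \<in> carrier F" if "i \<in> I" "l \<in> J - {p}" for i l
    using R[OF that] A[of i l] d[of i] v[of l] that by simp
  have piv: "A (i, p) \<ominus> d i \<otimes> v p = \<zero>" if "i \<in> I" for i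
    using A[OF that p(1)] ip v[OF p(1)] p(2) by (simp add: d_def m_assoc inv_mult minus_eq r_neg)
  have ym: "y x m = (\<Oplus>j\<in>J. v j \<otimes> x j)" for x
    by (simp add: y_def add_row_def)
  have yi: "y x i = (\<Oplus>j\<in>J. A (i, j) \<otimes> x j)" if "i \<in> I" for x i
  proof -
    have "i \<noteq> m" using that assms(1) by auto
    then show ?thesis using that by (simp add: y_def add_row_def)
  qed
  have yc: "y x m \<in> carrier F" "\<And>i. i \<in> I \<Longrightarrow> y x i \<in> carrier F" if x: "x \<in> J \<rightarrow>\<^sub>E carrier F" for x
  proof -
    have xc: "x j \<in> carrier F" if "j \<in> J" for j using x that by (rule PiE_mem)
    show "y x m \<in> carrier F" unfolding ym using xc v by (intro finsum_closed) auto
    show "y x i \<in> carrier F" if "i \<in> I" for i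
      unfolding yi[OF that] using xc A[OF that] by (intro finsum_closed) auto
  qed
  have \<Phi>_y: "\<Phi> (y x) = (y x m, z x)" if x: "x \<in> J \<rightarrow>\<^sub>E carrier F" for x
  proof -
    have xc: "x j \<in> carrier F" if "j \<in> J" for j using x that by (rule PiE_mem)
    have "y x i \<ominus> d i \<otimes> y x m = (\<Oplus>j\<in>J - {p}. ?R (i, j) \<otimes> x j)" if i: "i \<in> I" for i
    proof -
      have "y x i \<ominus> d i \<otimes> y x m = (\<Oplus>j\<in>J. A (i, j) \<otimes> x j) \<oplus> (\<ominus> d i) \<otimes> (\<Oplus>j\<in>J. v j \<otimes> x j)"
        using yc[OF x] i d by (simp add: minus_eq l_minus ym yi)
      also have "(\<ominus> d i) \<otimes> (\<Oplus>j\<in>J. v j \<otimes> x j) = (\<Oplus>j\<in>J. (\<ominus> d i) \<otimes> (v j \<otimes> x j))"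
        using assms(2) d[OF i] xc v by (intro finsum_rdistr) auto
      also have "(\<Oplus>j\<in>J. A (i, j) \<otimes> x j) \<oplus> \<dots>
          = (\<Oplus>j\<in>J. A (i, j) \<otimes> x j \<oplus> (\<ominus> d i) \<otimes> (v j \<otimes> x j))"
        using d[OF i] xc v A[OF i] by (intro finsum_addf[symmetric]) auto
      also have "\<dots> = (\<Oplus>j\<in>J. (A (i, j) \<ominus> d i \<otimes> v j) \<otimes> x j)"
        using d[OF i] xc v A[OF i]
        by (intro finsum_cong') (auto simp: minus_eq l_distr l_minus m_assoc)
      also have "J = insert p (J - {p})" using p by auto
      also have "(\<Oplus>j\<in>insert p (J - {p}). (A (i, j) \<ominus> d i \<otimes> v j) \<otimes> x j)
          = (A (i, p) \<ominus> d i \<otimes> v p) \<otimes> x p \<oplus> (\<Oplus>j\<in>J - {p}. (A (i, j) \<ominus> d i \<otimes> v j) \<otimes> x j)"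
        using d[OF i] xc v A[OF i] p assms(2) by (intro finsum_insert) auto
      also have "\<dots> = (\<Oplus>j\<in>J - {p}. (A (i, j) \<ominus> d i \<otimes> v j) \<otimes> x j)"
      proof -
        have "(\<Oplus>j\<in>J - {p}. (A (i, j) \<ominus> d i \<otimes> v j) \<otimes> x j) \<in> carrier F"
          using d[OF i] xc v A[OF i] by (intro finsum_closed) auto
        then show ?thesis using piv[OF i] xc[OF p(1)] by simp
      qed
      also have "\<dots> = (\<Oplus>j\<in>J - {p}. ?R (i, j) \<otimes> x j)"
        using R[OF i] Rc[OF i] xc by (intro finsum_cong') auto
      finally show ?thesis .
    qed
    then show ?thesis unfolding \<Phi>_def z_def by (auto intro!: restrict_ext)
  qed
  have "inj_on \<Phi> ?L"
    unfolding L
  proof (rule inj_onI, safe)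
    fix a b assume a: "a \<in> J \<rightarrow>\<^sub>E carrier F" and b: "b \<in> J \<rightarrow>\<^sub>E carrier F"
      and eq: "\<Phi> (y a) = \<Phi> (y b)"
    have m: "y a m = y b m" using eq by (simp add: \<Phi>_def)
    have "y a i = y b i" if i: "i \<in> I" for i
    proof -
      have "y a i \<ominus> d i \<otimes> y a m = y b i \<ominus> d i \<otimes> y b m"
        using eq i unfolding \<Phi>_def by (auto dest: fun_cong[where x = i])
      then have "(y a i \<ominus> d i \<otimes> y a m) \<oplus> d i \<otimes> y a m = (y b i \<ominus> d i \<otimes> y b m) \<oplus> d i \<otimes> y b m"
        using m by simp
      then show ?thesis using yc[OF a] yc[OF b] i d by (simp add: add_minus_cancel)
    qed
    moreover have "y a i = y b i" if "i \<notin> insert m I" for i using that by (simp add: y_def)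
    ultimately show "y a = y b" using m by (metis ext insertE)
  qed
  moreover have "\<Phi> ` ?L = carrier F \<times> col_space I (J - {p}) ?R"
  proof
    show "\<Phi> ` ?L \<subseteq> carrier F \<times> col_space I (J - {p}) ?R"
    proof -
      have "z x \<in> col_space I (J - {p}) ?R" if x: "x \<in> J \<rightarrow>\<^sub>E carrier F" for x
      proof -
        have xc: "x j \<in> carrier F" if "j \<in> J" for j using x that by (rule PiE_mem)
        have "z x = (\<lambda>i\<in>I. \<Oplus>j\<in>J - {p}. ?R (i, j) \<otimes> restrict x (J - {p}) j)"
          unfolding z_def using Rc xc by (intro restrict_ext finsum_cong') auto
        moreover have "restrict x (J - {p}) \<in> (J - {p}) \<rightarrow>\<^sub>E carrier F" using xc by auto
        ultimately show ?thesis unfolding col_space_def by (rule image_eqI)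
      qed
      then show ?thesis unfolding L using \<Phi>_y yc by auto
    qed
    show "carrier F \<times> col_space I (J - {p}) ?R \<subseteq> \<Phi> ` ?L"
    proof safe
      fix t w assume t: "t \<in> carrier F" and "w \<in> col_space I (J - {p}) ?R"
      then obtain x' where x': "x' \<in> (J - {p}) \<rightarrow>\<^sub>E carrier F"
        and w: "w = (\<lambda>i\<in>I. \<Oplus>j\<in>J - {p}. ?R (i, j) \<otimes> x' j)"
        unfolding col_space_def by auto
      have x'c: "x' j \<in> carrier F" if "j \<in> J - {p}" for j using x' that by (rule PiE_mem)
      define r where "r = (\<Oplus>j\<in>J - {p}. v j \<otimes> x' j)"
      have r: "r \<in> carrier F" unfolding r_def using x'c v by (intro finsum_closed) auto
      \<comment> \<open>The pivot coordinate is solved for so that the last entry becomes \<open>t\<close>.\<close>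
      define x where "x = x'(p := inv (v p) \<otimes> (t \<ominus> r))"
      have x: "x \<in> J \<rightarrow>\<^sub>E carrier F"
        using x'c PiE_arb[OF x'] p ip t r by (intro PiE_I) (auto simp: x_def)
      have "y x m = (\<Oplus>j\<in>insert p (J - {p}). v j \<otimes> x j)"
        using p(1) by (simp add: ym insert_absorb)
      also have "\<dots> = v p \<otimes> x p \<oplus> (\<Oplus>j\<in>J - {p}. v j \<otimes> x j)"
        using p assms(2) x v by (intro finsum_insert) (auto dest: PiE_mem)
      also have "(\<Oplus>j\<in>J - {p}. v j \<otimes> x j) = r"
        unfolding r_def using x'c v by (intro finsum_cong') (auto simp: x_def)
      also have "v p \<otimes> x p = t \<ominus> r"
        using ip t r v[OF p(1)] p(2) by (simp add: x_def m_assoc[symmetric] mult_inv)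
      finally have "y x m = t" using t r by (simp add: add_minus_cancel)
      moreover have "z x = w"
        unfolding z_def w using Rc x'c by (intro restrict_ext finsum_cong') (auto simp: x_def)
      ultimately have "(t, w) = \<Phi> (y x)" using \<Phi>_y[OF x] by simp
      then show "(t, w) \<in> \<Phi> ` ?L" unfolding L using x by blast
    qed
  qed
  ultimately have "card ?L = card (carrier F \<times> col_space I (J - {p}) ?R)" by (metis card_image)
  then show ?thesis by (simp add: card_cartesian_product)
qed

end

section \<open>The fibres of the elimination\<close>

text \<open>
  The zeros forced in the eliminated matrix.  Columns of \<open>K\<close> other than \<open>p\<close> have absorbed a nonzero
  multiple of column \<open>p\<close>, so a zero is forced there only if all entries involved were forced to be zero.
\<close>

definition merge_cols :: "'j \<Rightarrow> 'j set \<Rightarrow> ('i \<times> 'j) set \<Rightarrow> ('i \<times> 'j) set" where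
  "merge_cols p K S =
     {(i, l). l \<noteq> p \<and> (if l \<in> K then \<forall>k\<in>K. (i, k) \<in> S else (i, l) \<in> S)}"

definition free_rows :: "'i set \<Rightarrow> 'j set \<Rightarrow> ('i \<times> 'j) set \<Rightarrow> 'i set" where
  "free_rows I K S = {i \<in> I. \<forall>k\<in>K. (i, k) \<notin> S}"

context finite_field
begin

text \<open>
  A matrix \<open>A\<close> is recovered from its eliminated block \<open>B\<close> and its column \<open>p\<close>, call it \<open>w\<close>, through
  \<open>A (i, l) = B (i, l) + w i * c l\<close>.  The zero conditions on \<open>A\<close> turn into a condition on each \<open>w i\<close>
  separately, described by the set \<open>W B i\<close>.  This is everything if row \<open>i\<close> is free in all columns of
  \<open>K\<close>, and a single element otherwise: it is zero if \<open>(i, p) \<in> S\<close>, and if only the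
  other column \<open>k\<close> of \<open>K\<close> is restricted, it is the solution of \<open>B (i, k) + w i * c k = 0\<close>.  The bound
  \<open>card K \<le> 2\<close> guarantees that there are no two such equations with contradicting solutions.
\<close>

lemma card_eliminate_fibres:
  fixes I :: "'i set" and J :: "'j set"
  assumes "finite I" and "finite J"
    and v: "\<And>j. j \<in> J \<Longrightarrow> v j \<in> carrier F"
    and K: "K = {j \<in> J. v j \<noteq> \<zero>}" "card K \<le> 2" and p: "p \<in> K"
  shows "card {A \<in> mats I J S. P (eliminate I J p v A)} =
    q ^ card (free_rows I K S) * card {B \<in> mats I (J - {p}) (merge_cols p K S). P B}"
proof -
  define c where "c l = inv (v p) \<otimes> v l" for l
  have fK: "finite K" using K(1) assms(2) by simp
  have pJ: "p \<in> J" and vp: "v p \<in> carrier F" "v p \<noteq> \<zero>" using p K v by auto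
  have c: "c l \<in> carrier F" if "l \<in> J" for l
    using that v vp by (simp add: c_def inv_closed)
  have c0: "c l = \<zero>" if "l \<in> J" "l \<notin> K" for l
    using that vp K by (simp add: c_def inv_closed)
  have cn0: "c l \<noteq> \<zero>" if "l \<in> K" for l
  proof -
    have "inv (v p) \<noteq> \<zero>" using inv_mult[OF vp] vp by auto
    then show ?thesis
      using that K vp v by (auto simp: c_def inv_closed integral_iff)
  qed
  let ?S = "merge_cols p K S"
  define N where "N = {B \<in> mats I (J - {p}) ?S. P B}"
  define W where "W B i = {w \<in> carrier F. ((i, p) \<in> S \<longrightarrow> w = \<zero>) \<and>
      (\<forall>l\<in>J - {p}. (i, l) \<in> S \<longrightarrow> B (i, l) \<oplus> w \<otimes> c l = \<zero>)}" for B :: "'i \<times> 'j \<Rightarrow> 'a" and i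
  define \<Psi> where "\<Psi> A = (eliminate I J p v A, \<lambda>i\<in>I. A (i, p))" for A :: "'i \<times> 'j \<Rightarrow> 'a"
  define \<Theta> where "\<Theta> = (\<lambda>(B, w). \<lambda>(i, l)\<in>I \<times> J. if l = p then w i else B (i, l) \<oplus> w i \<otimes> c l)"
  have elim: "eliminate I J p v A (i, l) = A (i, l) \<ominus> A (i, p) \<otimes> c l"
    if "i \<in> I" "l \<in> J - {p}" for A :: "'i \<times> 'j \<Rightarrow> 'a" and i l
    using that by (simp add: eliminate_def c_def)
  have "bij_betw \<Psi> {A \<in> mats I J S. P (eliminate I J p v A)} (SIGMA B:N. PiE I (W B))"
    (is "bij_betw \<Psi> ?M ?T")
  proof (rule bij_betw_byWitness[where f' = \<Theta>])
    show "\<forall>A\<in>?M. \<Theta> (\<Psi> A) = A"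
    proof (intro ballI ext)
      fix A :: "'i \<times> 'j \<Rightarrow> 'a" and x :: "'i \<times> 'j"
      assume "A \<in> ?M"
      then have A: "A \<in> mats I J S" by simp
      obtain i l where x: "x = (i, l)" by (cases x)
      show "\<Theta> (\<Psi> A) x = A x"
      proof (cases "i \<in> I \<and> l \<in> J")
        case True
        then show ?thesis
          using matsD[OF A] elim[of i l A] c pJ by (simp add: x \<Theta>_def \<Psi>_def add_minus_cancel)
      qed (use matsD_undefined[OF A] in \<open>auto simp: x \<Theta>_def \<Psi>_def\<close>)
    qed
    show "\<forall>a\<in>?T. \<Psi> (\<Theta> a) = a"
    proof
      fix a assume "a \<in> ?T"
      then obtain B w where a: "a = (B, w)" and B: "B \<in> mats I (J - {p}) ?S" and w: "w \<in> PiE I (W B)"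
        unfolding N_def by auto
      have wc: "w i \<in> carrier F" if "i \<in> I" for i using PiE_mem[OF w that] by (simp add: W_def)
      have "eliminate I J p v (\<Theta> a) x = B x" for x
      proof -
        obtain i l where x: "x = (i, l)" by (cases x)
        show ?thesis
        proof (cases "i \<in> I \<and> l \<in> J - {p}")
          case True
          then show ?thesis
            using elim[of i l "\<Theta> a"] matsD[OF B, of i l] wc c pJ
            by (simp add: x \<Theta>_def a minus_add_cancel)
        next
          case False
          then show ?thesis
            using matsD_undefined[OF B] by (auto simp: x eliminate_def)
        qed
      qed
      moreover have "(\<lambda>i\<in>I. \<Theta> a (i, p)) = w"
        using PiE_arb[OF w] pJ by (auto simp: \<Theta>_def a)
      ultimately show "\<Psi> (\<Theta> a) = a" by (auto simp: \<Psi>_def a)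
    qed
    show "\<Psi> ` ?M \<subseteq> ?T"
    proof (rule image_subsetI)
      fix A assume "A \<in> ?M"
      then have A: "A \<in> mats I J S" and P: "P (eliminate I J p v A)" by auto
      let ?B = "eliminate I J p v A"
      have "?B \<in> mats I (J - {p}) ?S"
      proof (rule matsI)
        fix i l assume il: "i \<in> I" "l \<in> J - {p}"
        show "?B (i, l) \<in> carrier F"
          using elim[OF il] matsD[OF A] c il pJ by simp
        show "?B (i, l) = \<zero>" if "(i, l) \<in> ?S"
        proof (cases "l \<in> K")
          case True
          then have "A (i, l) = \<zero>" "A (i, p) = \<zero>"
            using that p pJ il by (auto simp: merge_cols_def intro!: matsD0[OF A])
          then show ?thesis using elim[OF il] c il by (simp add: minus_eq)
        next
          case False
          then have "A (i, l) = \<zero>"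
            using that il by (auto simp: merge_cols_def intro!: matsD0[OF A])
          then show ?thesis
            using elim[OF il] c0[of l] False il matsD[OF A, of i p] pJ by (simp add: minus_eq)
        qed
      qed (auto simp: eliminate_def)
      moreover have "(\<lambda>i\<in>I. A (i, p)) \<in> PiE I (W ?B)"
      proof (rule PiE_I)
        fix i assume i: "i \<in> I"
        have "?B (i, l) \<oplus> A (i, p) \<otimes> c l = \<zero>" if "l \<in> J - {p}" "(i, l) \<in> S" for l
          using elim[OF i that(1)] matsD[OF A i] c[of l] that pJ matsD0[OF A i _ that(2)]
          by (simp add: add_minus_cancel)
        then show "(\<lambda>i\<in>I. A (i, p)) i \<in> W ?B i"
          using i matsD[OF A i pJ] matsD0[OF A i pJ] by (auto simp: W_def)
      qed auto
      ultimately show "\<Psi> A \<in> ?T" using P by (simp add: \<Psi>_def N_def)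
    qed
    show "\<Theta> ` ?T \<subseteq> ?M"
    proof (rule image_subsetI)
      fix a assume aT: "a \<in> ?T"
      then obtain B w where a: "a = (B, w)" and B: "B \<in> mats I (J - {p}) ?S" "P B"
        and w: "w \<in> PiE I (W B)"
        unfolding N_def by auto
      have wW: "w i \<in> W B i" if "i \<in> I" for i using w that by (rule PiE_mem)
      then have wc: "w i \<in> carrier F" if "i \<in> I" for i using that by (auto simp: W_def)
      have "\<Theta> a \<in> mats I J S"
      proof (rule matsI)
        fix i l assume il: "i \<in> I" "l \<in> J"
        show "\<Theta> a (i, l) \<in> carrier F"
          using matsD[OF B(1), of i l] wc[OF il(1)] c il by (auto simp: \<Theta>_def a)
        show "\<Theta> a (i, l) = \<zero>" if "(i, l) \<in> S"
          using wW[OF il(1)] il that by (auto simp: \<Theta>_def a W_def)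
      qed (auto simp: \<Theta>_def a)
      moreover have "eliminate I J p v (\<Theta> a) = B"
      proof
        fix x :: "'i \<times> 'j"
        obtain i l where x: "x = (i, l)" by (cases x)
        show "eliminate I J p v (\<Theta> a) x = B x"
        proof (cases "i \<in> I \<and> l \<in> J - {p}")
          case True
          then show ?thesis
            using elim[of i l "\<Theta> a"] matsD[OF B(1), of i l] wc c pJ
            by (simp add: x \<Theta>_def a minus_add_cancel)
        next
          case False
          then show ?thesis
            using matsD_undefined[OF B(1)] by (auto simp: x eliminate_def)
        qed
      qed
      ultimately show "\<Theta> a \<in> ?M" using B(2) by simp
    qed
  qed
  then have "card ?M = card ?T" by (rule bij_betw_same_card)
  also have "\<dots> = (\<Sum>B\<in>N. card (PiE I (W B)))"
    using assms(1,2) finite_mats[of I "J - {p}"]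
    by (intro card_SigmaI) (auto simp: N_def W_def finite_carrier intro!: finite_PiE)
  also have "\<dots> = (\<Sum>B\<in>N. q ^ card (free_rows I K S))"
  proof (rule sum.cong[OF refl])
    fix B assume "B \<in> N"
    then have B: "B \<in> mats I (J - {p}) ?S" by (simp add: N_def)
    have W: "card (W B i) = (if i \<in> free_rows I K S then q else 1)" if i: "i \<in> I" for i
    proof -
      \<comment> \<open>Columns outside \<open>K\<close> put no constraint on \<open>w\<close>, as \<open>c l = 0\<close> there.\<close>
      have off: "B (i, l) \<oplus> w \<otimes> c l = \<zero>"
        if "l \<in> J - {p}" "l \<notin> K" "(i, l) \<in> S" "w \<in> carrier F" for l w
      proof -
        have "B (i, l) = \<zero>" by (rule matsD0[OF B i that(1)]) (use that in \<open>simp add: merge_cols_def\<close>)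
        then show ?thesis using that c0[of l] by simp
      qed
      consider (free) "i \<in> free_rows I K S" | (pivot) "(i, p) \<in> S"
        | (other) k where "(i, p) \<notin> S" "k \<in> K" "(i, k) \<in> S"
        using i by (auto simp: free_rows_def)
      then show ?thesis
      proof cases
        case free
        have "W B i = carrier F"
          using free off p by (auto simp: W_def free_rows_def)
        then show ?thesis using free by simp
      next
        case pivot
        \<comment> \<open>Here \<open>w = 0\<close> must satisfy the condition at \<open>l\<close> as well: for \<open>l \<in> K\<close> then \<open>K = {p, l}\<close>.\<close>
        have "B (i, l) = \<zero>" if l: "l \<in> J - {p}" "(i, l) \<in> S" for l
        proof (rule matsD0[OF B i l(1)])
          have "l \<in> K \<Longrightarrow> K = {p, l}"
            using K p l fK by (intro card_seteq[symmetric]) auto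
          then show "(i, l) \<in> ?S"
            using l pivot by (auto simp: merge_cols_def)
        qed
        then have "W B i = {\<zero>}" using pivot c by (auto simp: W_def)
        then show ?thesis using pivot p by (auto simp: free_rows_def)
      next
        case other
        then have kp: "k \<noteq> p" and kJ: "k \<in> J - {p}" using K by auto
        have Keq: "K = {p, k}"
          using K p other kp fK by (intro card_seteq[symmetric]) auto
        have ck: "c k \<in> carrier F" "c k \<noteq> \<zero>" using c[of k] cn0[of k] kJ other by auto
        have Bk: "B (i, k) \<in> carrier F" by (rule matsD[OF B i kJ])
        have sol: "B (i, k) \<oplus> w \<otimes> c k = \<zero> \<longleftrightarrow> w = \<ominus> B (i, k) \<otimes> inv (c k)"
          if w: "w \<in> carrier F" for w
        proof
          assume "B (i, k) \<oplus> w \<otimes> c k = \<zero>"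
          then have "w \<otimes> c k = \<ominus> B (i, k)"
            using Bk w ck by (metis m_closed minus_equality a_comm minus_minus)
          then have "w \<otimes> c k \<otimes> inv (c k) = \<ominus> B (i, k) \<otimes> inv (c k)" by simp
          then show "w = \<ominus> B (i, k) \<otimes> inv (c k)"
            using w ck by (simp add: m_assoc mult_inv inv_closed)
        next
          assume "w = \<ominus> B (i, k) \<otimes> inv (c k)"
          then show "B (i, k) \<oplus> w \<otimes> c k = \<zero>"
            using Bk ck by (simp add: m_assoc inv_mult inv_closed r_neg)
        qed
        have "W B i = {\<ominus> B (i, k) \<otimes> inv (c k)}"
        proof -
          have "\<ominus> B (i, k) \<otimes> inv (c k) \<in> carrier F" using Bk ck by (simp add: inv_closed)
          moreover have "w \<in> W B i \<longleftrightarrow> w \<in> carrier F \<and> B (i, k) \<oplus> w \<otimes> c k = \<zero>" for w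
            using other kJ off[of _ w] unfolding W_def Keq by blast
          ultimately show ?thesis using sol by auto
        qed
        then show ?thesis using other by (auto simp: free_rows_def)
      qed
    qed
    have "card (PiE I (W B)) = (\<Prod>i\<in>I. if i \<in> free_rows I K S then q else 1)"
      using assms(1) by (simp add: card_PiE W cong: prod.cong)
    also have "\<dots> = (\<Prod>i\<in>free_rows I K S. q)"
      using assms(1) by (intro prod.mono_neutral_cong_right) (auto simp: free_rows_def)
    finally show "card (PiE I (W B)) = q ^ card (free_rows I K S)" by simp
  qed
  finally show ?thesis by (simp add: N_def)
qed

section \<open>Summation over the last row\<close>

text \<open>
  The last row ranges over all vectors whose support \<open>K\<close> lies in the set \<open>D\<close> of free positions.  Its
  contribution depends on \<open>K\<close> alone, by the two rank computations and the count of fibres.  Rank \<open>0\<close>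
  needs a case of its own because a nonzero last row makes the rank positive, whereas
  \<open>r - 1\<close> truncates.  The function \<open>p\<close> is an arbitrary choice of pivots.
\<close>

theorem count_mats_recursion:
  fixes I :: "'i set" and J :: "'j set"
  assumes "m \<notin> I" and "finite I" and "finite J"
    and D: "D = {j \<in> J. (m, j) \<notin> S}" "card D \<le> 2"
    and p: "\<And>K. K \<subseteq> D \<Longrightarrow> K \<noteq> {} \<Longrightarrow> p K \<in> K"
  shows "count_mats (insert m I) J S (q ^ r) =
    (\<Sum>K\<in>Pow D. (q - 1) ^ card K * (if K = {} then count_mats I J S (q ^ r)
       else if r = 0 then 0
       else q ^ card (free_rows I K S)
         * count_mats I (J - {p K}) (merge_cols (p K) K S) (q ^ (r - 1))))"
proof -
  let ?N = "\<lambda>v. card {A \<in> mats I J S. card (col_space (insert m I) J (add_row m v A)) = q ^ r}"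
  let ?G = "\<lambda>K. if K = {} then count_mats I J S (q ^ r)
       else if r = 0 then 0
       else q ^ card (free_rows I K S)
         * count_mats I (J - {p K}) (merge_cols (p K) K S) (q ^ (r - 1))"
  define supp where "supp v = {j \<in> J. v j \<noteq> \<zero>}" for v :: "'j \<Rightarrow> 'a"
  have fD: "finite D" using D(1) assms(3) by simp
  have suppD: "supp v \<subseteq> D" if "v \<in> rows m J S" for v
    using rowsD0[OF that] by (auto simp: supp_def D(1))
  have N: "?N v = ?G (supp v)" if v: "v \<in> rows m J S" for v
  proof (cases "supp v = {}")
    case True
    then have "card (col_space (insert m I) J (add_row m v A)) = card (col_space I J A)"
      if "A \<in> mats I J S" for A
      using that assms(1) by (intro card_col_space_zero_row) (auto simp: supp_def matsD)
    then have "?N v = count_mats I J S (q ^ r)"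
      unfolding count_mats_def by (intro arg_cong[where f = card]) auto
    then show ?thesis using True by simp
  next
    case False
    let ?K = "supp v" and ?p = "p (supp v)"
    have pK: "?p \<in> ?K" using p[OF suppD[OF v] False] .
    have "card (col_space (insert m I) J (add_row m v A))
        = q * card (col_space I (J - {?p}) (eliminate I J ?p v A))" if "A \<in> mats I J S" for A
      using that assms(1,3) pK rowsD[OF v] by (intro card_col_space_pivot) (auto simp: supp_def matsD)
    then have "?N v = card {A \<in> mats I J S.
        q * card (col_space I (J - {?p}) (eliminate I J ?p v A)) = q ^ r}"
      by (intro arg_cong[where f = card]) auto
    also have "\<dots> = q ^ card (free_rows I ?K S) * card {B \<in> mats I (J - {?p}) (merge_cols ?p ?K S).
        q * card (col_space I (J - {?p}) B) = q ^ r}"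
      using assms(2,3) rowsD[OF v] pK card_mono[OF fD suppD[OF v]] D(2)
      by (intro card_eliminate_fibres[where P = "\<lambda>B. q * card (col_space I (J - {?p}) B) = q ^ r"])
         (auto simp: supp_def)
    also have "\<dots> = ?G ?K"
    proof (cases r)
      case 0
      have "q * x \<noteq> 1" for x :: nat using q_ge_2 by auto
      then show ?thesis using 0 False by simp
    next
      case (Suc k)
      then show ?thesis using False q_ge_2 by (auto simp: count_mats_def)
    qed
    finally show ?thesis .
  qed
  have cnt: "card {v \<in> rows m J S. supp v = K} = (q - 1) ^ card K" if K: "K \<in> Pow D" for K
  proof -
    have "{v \<in> rows m J S. supp v = K} = (\<Pi>\<^sub>E j\<in>J. if j \<in> K then carrier F - {\<zero>} else {\<zero>})"
      (is "?L = ?R")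
    proof
      show "?L \<subseteq> ?R"
      proof
        fix v assume "v \<in> ?L"
        then have v: "v \<in> rows m J S" and s: "supp v = K" by auto
        show "v \<in> ?R"
          using rowsD[OF v] PiE_arb[OF v] s by (intro PiE_I) (auto simp: supp_def)
      qed
      show "?R \<subseteq> ?L"
      proof
        fix v assume v: "v \<in> ?R"
        have vj: "v j \<in> (if j \<in> K then carrier F - {\<zero>} else {\<zero>})" if "j \<in> J" for j
          using v that by (rule PiE_mem)
        have "v \<in> rows m J S"
        proof (rule PiE_I)
          fix j assume "j \<in> J"
          then show "v j \<in> (if (m, j) \<in> S then {\<zero>} else carrier F)"
            using vj[of j] K D(1) by (auto split: if_splits)
        qed (use PiE_arb[OF v] in auto)
        moreover have "supp v = K"
          using vj K D(1) by (force simp: supp_def split: if_splits)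
        ultimately show "v \<in> ?L" by simp
      qed
    qed
    then have "card {v \<in> rows m J S. supp v = K} = (\<Prod>j\<in>J. if j \<in> K then q - 1 else 1)"
      using assms(3) by (simp add: card_PiE if_distrib card_Diff_singleton finite_carrier cong: if_cong)
    also have "\<dots> = (\<Prod>j\<in>K. q - 1)"
      using assms(3) K D(1) by (intro prod.mono_neutral_cong_right) auto
    finally show ?thesis by simp
  qed
  have fr: "finite (rows m J S)"
    using assms(3) by (intro finite_PiE) (auto simp: finite_carrier)
  have "count_mats (insert m I) J S (q ^ r) = (\<Sum>v\<in>rows m J S. ?N v)"
    by (rule count_mats_insert_row[OF assms(1-3)])
  also have "\<dots> = (\<Sum>v\<in>rows m J S. ?G (supp v))" by (rule sum.cong[OF refl N])
  also have "\<dots> = (\<Sum>K\<in>Pow D. \<Sum>v | v \<in> rows m J S \<and> supp v = K. ?G (supp v))"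
    using fr fD suppD by (intro sum.group[symmetric]) auto
  also have "\<dots> = (\<Sum>K\<in>Pow D. (q - 1) ^ card K * ?G K)"
  proof (rule sum.cong[OF refl])
    fix K assume K: "K \<in> Pow D"
    have "(\<Sum>v | v \<in> rows m J S \<and> supp v = K. ?G (supp v)) = (\<Sum>v | v \<in> rows m J S \<and> supp v = K. ?G K)"
      by (rule sum.cong) auto
    also have "\<dots> = (q - 1) ^ card K * ?G K" by (simp only: sum_constant cnt[OF K] of_nat_id)
    finally show "(\<Sum>v | v \<in> rows m J S \<and> supp v = K. ?G (supp v)) = (q - 1) ^ card K * ?G K" .
  qed
  finally show ?thesis .
qed

section \<open>Reduction to smaller matrices\<close>

text \<open>
  Renaming the columns permutes the summands of every linear combination of columns, so the column
  space stays literally the same.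
\<close>

lemma count_mats_relabel:
  fixes I :: "'i set" and J :: "'j set" and J' :: "'k set"
  assumes \<tau>: "bij_betw \<tau> J J'"
  shows "count_mats I J' {(i, \<tau> l) |i l. i \<in> I \<and> l \<in> J \<and> (i, l) \<in> S} s = count_mats I J S s"
proof -
  let ?S' = "{(i, \<tau> l) |i l. i \<in> I \<and> l \<in> J \<and> (i, l) \<in> S}"
  let ?\<sigma> = "the_inv_into J \<tau>"
  define \<Phi> where "\<Phi> A = (\<lambda>(i, l)\<in>I \<times> J. A (i, \<tau> l))" for A :: "'i \<times> 'k \<Rightarrow> 'a"
  define \<Theta> where "\<Theta> B = (\<lambda>(i, l')\<in>I \<times> J'. B (i, ?\<sigma> l'))" for B :: "'i \<times> 'j \<Rightarrow> 'a"
  have inj: "inj_on \<tau> J" and img: "\<tau> ` J = J'" using \<tau> by (auto simp: bij_betw_def)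
  have t: "\<tau> l \<in> J'" "?\<sigma> (\<tau> l) = l" if "l \<in> J" for l
    using that inj img by (auto simp: the_inv_into_f_f)
  have s: "?\<sigma> l' \<in> J" "\<tau> (?\<sigma> l') = l'" if "l' \<in> J'" for l'
    using that inj img by (auto simp: f_the_inv_into_f the_inv_into_into)
  have S': "(i, \<tau> l) \<in> ?S' \<longleftrightarrow> (i, l) \<in> S" if "i \<in> I" "l \<in> J" for i l
    using that inj by (auto dest: inj_onD)
  have col: "col_space I J (\<Phi> A) = col_space I J' A" if A: "A \<in> mats I J' ?S'" for A
  proof -
    have sum: "(\<Oplus>l\<in>J. \<Phi> A (i, l) \<otimes> x (\<tau> l)) = (\<Oplus>l'\<in>J'. A (i, l') \<otimes> x l')"
      if "i \<in> I" and x: "\<And>l'. l' \<in> J' \<Longrightarrow> x l' \<in> carrier F" for i x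
    proof -
      have "(\<Oplus>l\<in>J. \<Phi> A (i, l) \<otimes> x (\<tau> l)) = (\<Oplus>l\<in>J. A (i, \<tau> l) \<otimes> x (\<tau> l))"
        using matsD[OF A that(1)] x t that(1) by (intro finsum_cong') (auto simp: \<Phi>_def)
      also have "\<dots> = (\<Oplus>l'\<in>\<tau> ` J. A (i, l') \<otimes> x l')"
        using matsD[OF A that(1)] x t inj by (intro finsum_reindex[symmetric]) auto
      finally show ?thesis by (simp add: img)
    qed
    show ?thesis
    proof
      show "col_space I J (\<Phi> A) \<subseteq> col_space I J' A"
      proof
        fix y assume "y \<in> col_space I J (\<Phi> A)"
        then obtain x where x: "x \<in> J \<rightarrow>\<^sub>E carrier F" "y = (\<lambda>i\<in>I. \<Oplus>l\<in>J. \<Phi> A (i, l) \<otimes> x l)"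
          unfolding col_space_def by auto
        have xc: "x j \<in> carrier F" if "j \<in> J" for j using x(1) that by (rule PiE_mem)
        let ?x = "\<lambda>l'\<in>J'. x (?\<sigma> l')"
        have "(\<Oplus>l\<in>J. \<Phi> A (i, l) \<otimes> x l) = (\<Oplus>l\<in>J. \<Phi> A (i, l) \<otimes> ?x (\<tau> l))" if "i \<in> I" for i
          using xc t matsD[OF A that] that by (intro finsum_cong') (auto simp: \<Phi>_def)
        moreover have "?x l' \<in> carrier F" if "l' \<in> J'" for l' using that xc s by auto
        ultimately have "y = (\<lambda>i\<in>I. \<Oplus>l'\<in>J'. A (i, l') \<otimes> ?x l')"
          unfolding x(2) using sum[of _ ?x] by (intro restrict_ext) auto
        moreover have "?x \<in> J' \<rightarrow>\<^sub>E carrier F" using xc s by auto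
        ultimately show "y \<in> col_space I J' A" unfolding col_space_def by (rule image_eqI)
      qed
      show "col_space I J' A \<subseteq> col_space I J (\<Phi> A)"
      proof
        fix y assume "y \<in> col_space I J' A"
        then obtain x where x: "x \<in> J' \<rightarrow>\<^sub>E carrier F" "y = (\<lambda>i\<in>I. \<Oplus>l'\<in>J'. A (i, l') \<otimes> x l')"
          unfolding col_space_def by auto
        have xc: "x j \<in> carrier F" if "j \<in> J'" for j using x(1) that by (rule PiE_mem)
        let ?x = "\<lambda>l\<in>J. x (\<tau> l)"
        have "(\<Oplus>l\<in>J. \<Phi> A (i, l) \<otimes> ?x l) = (\<Oplus>l\<in>J. \<Phi> A (i, l) \<otimes> x (\<tau> l))" if "i \<in> I" for i
          using xc t matsD[OF A that] that by (intro finsum_cong') (auto simp: \<Phi>_def)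
        then have "y = (\<lambda>i\<in>I. \<Oplus>l\<in>J. \<Phi> A (i, l) \<otimes> ?x l)"
          unfolding x(2) using sum[of _ x] xc by (intro restrict_ext) auto
        moreover have "?x \<in> J \<rightarrow>\<^sub>E carrier F" using xc t by auto
        ultimately show "y \<in> col_space I J (\<Phi> A)" unfolding col_space_def by (rule image_eqI)
      qed
    qed
  qed
  have "bij_betw \<Phi> (mats I J' ?S') (mats I J S)"
  proof (rule bij_betw_byWitness[where f' = \<Theta>])
    show "\<forall>A\<in>mats I J' ?S'. \<Theta> (\<Phi> A) = A"
    proof (intro ballI ext)
      fix A x assume A: "A \<in> mats I J' ?S'"
      show "\<Theta> (\<Phi> A) x = A x"
        using matsD_undefined[OF A, of "fst x" "snd x"] s by (cases x) (auto simp: \<Theta>_def \<Phi>_def)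
    qed
    show "\<forall>B\<in>mats I J S. \<Phi> (\<Theta> B) = B"
    proof (intro ballI ext)
      fix B x assume B: "B \<in> mats I J S"
      show "\<Phi> (\<Theta> B) x = B x"
        using matsD_undefined[OF B, of "fst x" "snd x"] t by (cases x) (auto simp: \<Theta>_def \<Phi>_def)
    qed
    show "\<Phi> ` mats I J' ?S' \<subseteq> mats I J S"
    proof (rule image_subsetI)
      fix A assume A: "A \<in> mats I J' ?S'"
      show "\<Phi> A \<in> mats I J S"
        using matsD[OF A] matsD0[OF A _ _ S'[THEN iffD2]] t by (intro matsI) (auto simp: \<Phi>_def)
    qed
    show "\<Theta> ` mats I J S \<subseteq> mats I J' ?S'"
    proof (rule image_subsetI)
      fix B assume B: "B \<in> mats I J S"
      have "B (i, ?\<sigma> l') = \<zero>" if "i \<in> I" "l' \<in> J'" "(i, l') \<in> ?S'" for i l'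
        using that s[OF that(2)] S'[OF that(1) s(1)[OF that(2)]] by (intro matsD0[OF B]) auto
      then show "\<Theta> B \<in> mats I J' ?S'"
        using matsD[OF B] s by (intro matsI) (auto simp: \<Theta>_def)
    qed
  qed
  then have bij: "bij_betw \<Phi> (mats I J' ?S') (mats I J S)" .
  have "bij_betw \<Phi> {A \<in> mats I J' ?S'. card (col_space I J' A) = s}
      {B \<in> mats I J S. card (col_space I J B) = s}"
    by (rule bij_betw_Collect[OF bij]) (simp add: col)
  then show ?thesis unfolding count_mats_def by (rule bij_betw_same_card)
qed

lemma mats_Int: "mats I J (S \<inter> I \<times> J) = mats I J S"
  unfolding mats_def by (rule PiE_cong) auto

lemma count_mats_Int: "count_mats I J (S \<inter> I \<times> J) s = count_mats I J S s"
  by (simp add: count_mats_def mats_Int)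

end

text \<open>
  The order-preserving renumbering of the columns after deletion of column \<open>p\<close>.
\<close>

definition skip :: "nat \<Rightarrow> nat \<Rightarrow> nat" where
  "skip p l = (if l < p then l else l - 1)"

lemma bij_betw_skip:
  assumes "p \<in> {1..n}"
  shows "bij_betw (skip p) ({1..n} - {p}) {1..n - 1}"
  by (rule bij_betw_byWitness[where f' = "\<lambda>l. if l < p then l else l + 1"])
     (use assms in \<open>auto simp: skip_def\<close>)

theorem theorem3p8:
  fixes m n r :: nat and S :: "(nat \<times> nat) set"
  assumes "m \<ge> 1" and "n \<ge> 1"
    and "S \<subseteq> {1..m} \<times> {1..n}"
    and "card {j. (m, j) \<in> ({1..m} \<times> {1..n}) - S} \<le> 2"
  shows "\<exists>T :: (nat \<times> nat \<times> (nat \<times> nat) set \<times> nat \<times> int poly) list.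
    (\<forall>(m', n', S', r', c) \<in> set T.
        m' \<le> m \<and> n' \<le> n \<and> (m', n') \<noteq> (m, n) \<and> S' \<subseteq> {1..m'} \<times> {1..n'}) \<and>
    (\<forall>q :: nat. primepow q \<longrightarrow> (\<forall>F :: nat ring. field F \<and> card (carrier F) = q \<longrightarrow>
        int (mat_count F m n S r) =
          (\<Sum>(m', n', S', r', c) \<leftarrow> T. poly c (int q) * int (mat_count F m' n' S' r'))))"
proof -
  define I where "I = {1..m - 1}"
  define D where "D = {j \<in> {1..n}. (m, j) \<notin> S}"
  define S' where "S' K = {(i, skip (Min K) l) |i l. i \<in> I \<and> l \<in> {1..n} - {Min K}
      \<and> (i, l) \<in> merge_cols (Min K) K S}" for K
  \<comment> \<open>For \<open>r = 0\<close> the coefficient must be \<open>0\<close>, since \<open>r - 1\<close> would denote rank \<open>0\<close> again.\<close>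
  define c :: "nat set \<Rightarrow> int poly" where
    "c K = (if r = 0 then 0 else [:-1, 1:] ^ card K * [:0, 1:] ^ card (free_rows I K S))"
    for K :: "nat set"
  define t :: "nat set \<Rightarrow> nat \<times> nat \<times> (nat \<times> nat) set \<times> nat \<times> int poly" where
    "t K = (if K = {} then (m - 1, n, S \<inter> I \<times> {1..n}, r, 1) else (m - 1, n - 1, S' K, r - 1, c K))"
    for K
  have D: "card D \<le> 2" "finite D"
  proof -
    have "D = {j. (m, j) \<in> ({1..m} \<times> {1..n}) - S}" using assms(1) by (auto simp: D_def)
    then show "card D \<le> 2" using assms(4) by simp
  qed (simp add: D_def)
  have Min: "Min K \<in> K" if "K \<subseteq> D" "K \<noteq> {}" for K
    using that D(2) by (intro Min_in) (auto intro: finite_subset)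
  have Min_n: "Min K \<in> {1..n}" if "K \<subseteq> D" "K \<noteq> {}" for K
    using Min[OF that] that by (auto simp: D_def)
  have S': "S' K \<subseteq> {1..m - 1} \<times> {1..n - 1}" if "K \<subseteq> D" "K \<noteq> {}" for K
    using bij_betw_imp_surj_on[OF bij_betw_skip[OF Min_n[OF that]]] by (auto simp: S'_def I_def)
  obtain Ks where Ks: "set Ks = Pow D" "distinct Ks"
    using finite_distinct_list[of "Pow D"] D(2) by auto
  have "int (mat_count F m n S r) =
      (\<Sum>(m', n', S', r', c) \<leftarrow> map t Ks. poly c (int q) * int (mat_count F m' n' S' r'))"
    if "primepow q" and F: "field F" "card (carrier F) = q" for q and F :: "nat ring"
  proof -
    have "q > 0" using that(1) by (rule primepow_gt_0_nat)
    then have "finite (carrier F)" using F(2) by (auto intro: card_ge_0_finite)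
    then interpret finite_field F
      using F(1) by (simp add: finite_field_def finite_field_axioms_def)
    have m: "insert m I = {1..m}" "m \<notin> I" using assms(1) by (auto simp: I_def)
    have fin: "finite I" "finite {1..n}" by (auto simp: I_def)
    have rec: "count_mats (insert m I) {1..n} S (q ^ r)
      = (\<Sum>K\<in>Pow D. (q - 1) ^ card K * (if K = {} then count_mats I {1..n} S (q ^ r)
       else if r = 0 then 0
       else q ^ card (free_rows I K S)
         * count_mats I ({1..n} - {Min K}) (merge_cols (Min K) K S) (q ^ (r - 1))))"
      unfolding F(2)[symmetric]
      by (rule count_mats_recursion[where p = Min, OF m(2) fin D_def D(1)], rule Min)
    let ?f = "\<lambda>(m', n', S', r', c). poly c (int q) * int (mat_count F m' n' S' r')"
    have "int (mat_count F m n S r) = int (count_mats (insert m I) {1..n} S (q ^ r))"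
      using mat_count_eq_count_mats[OF assms(3)] F(2) m by simp
    also have "\<dots> = (\<Sum>K\<in>Pow D. int ((q - 1) ^ card K * (if K = {} then count_mats I {1..n} S (q ^ r)
       else if r = 0 then 0
       else q ^ card (free_rows I K S)
         * count_mats I ({1..n} - {Min K}) (merge_cols (Min K) K S) (q ^ (r - 1)))))"
      by (simp only: rec of_nat_sum)
    also have "\<dots> = (\<Sum>K\<in>Pow D. ?f (t K))"
    proof (rule sum.cong[OF refl])
      fix K assume "K \<in> Pow D"
      then have K: "K \<subseteq> D" by simp
      show "int ((q - 1) ^ card K * (if K = {} then count_mats I {1..n} S (q ^ r)
         else if r = 0 then 0
         else q ^ card (free_rows I K S)
           * count_mats I ({1..n} - {Min K}) (merge_cols (Min K) K S) (q ^ (r - 1)))) = ?f (t K)"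
      proof (cases "K = {}")
        case True
        have "mat_count F (m - 1) n (S \<inter> I \<times> {1..n}) r = count_mats I {1..n} S (q ^ r)"
          using mat_count_eq_count_mats[of "S \<inter> I \<times> {1..n}" "m - 1" n r] F(2)
            count_mats_Int[of I "{1..n}" S] by (simp add: I_def)
        then show ?thesis using True by (simp add: t_def)
      next
        case False
        have "mat_count F (m - 1) (n - 1) (S' K) (r - 1)
            = count_mats I {1..n - 1} (S' K) (q ^ (r - 1))"
          using mat_count_eq_count_mats[OF S'[OF K False]] F(2) by (simp add: I_def)
        also have "\<dots> = count_mats I ({1..n} - {Min K}) (merge_cols (Min K) K S) (q ^ (r - 1))"
          unfolding S'_def by (rule count_mats_relabel[OF bij_betw_skip[OF Min_n[OF K False]]])
        finally show ?thesis
          using False \<open>q > 0\<close> by (simp add: t_def c_def of_nat_diff)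
      qed
    qed
    also have "\<dots> = (\<Sum>x \<leftarrow> map t Ks. ?f x)"
      using sum_list_distinct_conv_sum_set[OF Ks(2), of "\<lambda>K. ?f (t K)"] Ks(1)
      by (simp add: o_def)
    finally show ?thesis .
  qed
  moreover have "\<forall>(m', n', S', r', c) \<in> set (map t Ks).
      m' \<le> m \<and> n' \<le> n \<and> (m', n') \<noteq> (m, n) \<and> S' \<subseteq> {1..m'} \<times> {1..n'}"
    using assms(1) S' by (auto simp: t_def I_def Ks(1))
  ultimately show ?thesis by (intro exI[of _ "map t Ks"]) blast
qed

end
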